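(* Every $k$-$T_2$-ordered (i.e. compactly generated $T_2$-ordered) locally compact space $(E,\mathscr{T},\le)$ is weakly convex.
   Context: A topological preordered space is a triple $(E,\mathscr{T},\le)$ with $(E,\mathscr{T})$ a topological space and $\le$ a reflexive and transitive relation. Set $i(S)=\{y: x\le y \text{ for some } x\in S\}$, $d(S)=\{y: y\le x \text{ for some } x\in S\}$. A set $S$ is increasing if $i(S)=S$, decreasing if $d(S)=S$, and convex if it is the intersection of a decreasing and an increasing set (equivalently $S=d(S)\cap i(S)$). The space is $T_2$-preordered if the graph $G(\le)=\{(x,y):x\le y\}$ is closed in $E\times E$. A $T_2$-preordered space is compactly generated ($k$-$T_2$-preordered) if there is a relation $R\subset G(\le)$ such that (i) for every compact set $K$ the set $\overline{R(K)}$ is compact, where $R(K)=\{y: (x,y)\in R \text{ for some } x\in K\}$, and (ii) $\le$ is the smallest closed preorder containing $R$. It is $k$-$T_2$-ordered if moreover $\le$ is antisymmetric. Locally compact means that each point has a compact neighborhood. The space is weakly convex at $x$ if the convex open neighborhoods of $x$ form a base of the neighborhood system of $x$, and weakly convex if this holds at every point. *)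

theory Defs
  imports "HOL-Analysis.Analysis"
begin

text \<open>
  A topological preordered space is a topology \<open>X\<close> together with the graph
  \<open>G = {(x, y). x \<le> y}\<close> of a preorder on \<open>topspace X\<close>. Thus \<open>i(S) = G `` S\<close>,
  \<open>d(S) = G\<inverse> `` S\<close> and \<open>R(K) = R `` K\<close>.
\<close>

definition increasing_set :: "'a rel \<Rightarrow> 'a set \<Rightarrow> bool"
  where "increasing_set G S \<longleftrightarrow> G `` S = S"

definition decreasing_set :: "'a rel \<Rightarrow> 'a set \<Rightarrow> bool"
  where "decreasing_set G S \<longleftrightarrow> G\<inverse> `` S = S"

definition order_convex :: "'a rel \<Rightarrow> 'a set \<Rightarrow> bool"
  where "order_convex G S \<longleftrightarrow>
    (\<exists>D I. decreasing_set G D \<and> increasing_set G I \<and> S = D \<inter> I)"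

definition closed_preorder :: "'a topology \<Rightarrow> 'a rel \<Rightarrow> bool"
  where "closed_preorder X G \<longleftrightarrow>
    preorder_on (topspace X) G \<and> closedin (prod_topology X X) G"

definition k_T2_preordered :: "'a topology \<Rightarrow> 'a rel \<Rightarrow> bool"
  where "k_T2_preordered X G \<longleftrightarrow>
    closed_preorder X G \<and>
    (\<exists>R \<subseteq> G.
       (\<forall>K. compactin X K \<longrightarrow> compactin X (X closure_of (R `` K))) \<and>
       (\<forall>H. closed_preorder X H \<and> R \<subseteq> H \<longrightarrow> G \<subseteq> H))"

definition k_T2_ordered :: "'a topology \<Rightarrow> 'a rel \<Rightarrow> bool"
  where "k_T2_ordered X G \<longleftrightarrow> k_T2_preordered X G \<and> antisym G"

definition weakly_convex_at :: "'a topology \<Rightarrow> 'a rel \<Rightarrow> 'a \<Rightarrow> bool"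
  where "weakly_convex_at X G x \<longleftrightarrow>
    neighbourhood_base_at x (\<lambda>V. openin X V \<and> order_convex G V) X"

definition weakly_convex :: "'a topology \<Rightarrow> 'a rel \<Rightarrow> bool"
  where "weakly_convex X G \<longleftrightarrow> (\<forall>x \<in> topspace X. weakly_convex_at X G x)"

end

theory Submission
  imports Defs
begin

text \<open>
  The point of compact generation is that the order cannot leave a compact set without being
  seen. Let \<open>Q\<close> be open, contained in a compact set \<open>C\<close>, and let \<open>K\<close> be the compact set
  \<open>(cl (R(C)) \<union> C) - Q\<close>. Every pair \<open>y \<le> z\<close> with \<open>y \<in> Q\<close> and \<open>z \<notin> Q\<close> has an intermediate point
  in \<open>K\<close>. This is clear for pairs in \<open>R\<close>, and the pairs of \<open>\<le>\<close> that satisfy it form a closed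
  preorder, so by minimality it holds for all of \<open>\<le>\<close>
  (\<open>compactly_generated_intermediate_point\<close>).

  Antisymmetry and closedness of the order make the space Hausdorff, so by local compactness each
  neighbourhood of \<open>x\<close> contains such a \<open>C\<close> with \<open>x \<in> Q\<close>. No point \<open>k \<in> K\<close> satisfies \<open>x \<le> k \<le> x\<close>, and
  since \<open>K\<close> is compact the same is true of \<open>y \<le> k \<le> w\<close> for all \<open>y\<close>, \<open>w\<close> in a small
  neighbourhood \<open>W\<close> of \<open>x\<close>. Hence whatever lies between two points of \<open>W\<close> lies in \<open>Q\<close>
  (\<open>small_neighbourhood_hull\<close>), and the problem has become one about the compact set \<open>C\<close>.
  There Nachbin's argument applies: \<open>C - W\<close> is the union of two compact sets, one without points
  below \<open>x\<close> and one without points above \<open>x\<close>; removing from \<open>W\<close> the increasing hull of the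
  first and the decreasing hull of the second leaves an open neighbourhood of \<open>x\<close>. It is convex:
  a point between two of its points avoids both hulls, hence \<open>C - W\<close>, but lies in \<open>C\<close>.
\<close>

section \<open>Closed relations and compact sets\<close>

text \<open>Projection along a compact factor is a closed map.\<close>

lemma closedin_Image_compactin:
  assumes S: "closedin (prod_topology X Y) S" and K: "compactin X K"
  shows "closedin Y (S `` K)"
proof -
  have KX: "K \<subseteq> topspace X"
    using K by (rule compactin_subset_topspace)
  have "closed_map (prod_topology (subtopology X K) Y) Y snd"
    by (rule Abstract_Topological_Spaces.closed_map_snd) (use K in \<open>simp add: compact_space_subtopology\<close>)
  moreover have "closedin (prod_topology (subtopology X K) Y) (S \<inter> K \<times> topspace Y)"
    unfolding prod_topology_subtopology closedin_subtopology using S by blast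
  ultimately have "closedin Y (snd ` (S \<inter> K \<times> topspace Y))"
    by (simp add: closed_map_def)
  moreover have "snd ` (S \<inter> K \<times> topspace Y) = S `` K"
    using closedin_subset[OF S] by force
  ultimately show ?thesis
    by simp
qed

lemma compactin_Diff_openin:
  assumes "compactin X A" and "openin X U"
  shows "compactin X (A - U)"
proof -
  have "A - U = A \<inter> (topspace X - U)"
    using compactin_subset_topspace[OF assms(1)] by blast
  then show ?thesis
    using assms by (auto intro: compact_Int_closedin)
qed

lemma closedin_converse:
  assumes "closedin (prod_topology X Y) S"
  shows "closedin (prod_topology Y X) (S\<inverse>)"
proof -
  have "continuous_map (prod_topology Y X) (prod_topology X Y) (\<lambda>p. (snd p, fst p))"
    by (intro continuous_intros continuous_map_fst continuous_map_snd)
  then have "closedin (prod_topology Y X)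
      {p \<in> topspace (prod_topology Y X). (snd p, fst p) \<in> S}"
    using assms by (rule closedin_continuous_map_preimage)
  moreover have "{p \<in> topspace (prod_topology Y X). (snd p, fst p) \<in> S} = S\<inverse>"
    using closedin_subset[OF assms] by auto
  ultimately show ?thesis
    by simp
qed

text \<open>
  The triples \<open>(k, x, z)\<close> with \<open>(x, k) \<in> S\<close> and \<open>(k, z) \<in> T\<close> form a closed relation between
  \<open>Y\<close> and the product of \<open>X\<close> and \<open>Z\<close>, and quantifying over \<open>k \<in> K\<close> takes the image of \<open>K\<close>.
\<close>

lemma closedin_relcomp_via_compactin:
  assumes S: "closedin (prod_topology X Y) S" and T: "closedin (prod_topology Y Z) T"
    and K: "compactin Y K"
  shows "closedin (prod_topology X Z) {(x, z). \<exists>k\<in>K. (x, k) \<in> S \<and> (k, z) \<in> T}"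
proof -
  let ?P = "prod_topology Y (prod_topology X Z)"
  let ?S = "{p \<in> topspace ?P. (fst (snd p), fst p) \<in> S}"
  let ?T = "{p \<in> topspace ?P. (fst p, snd (snd p)) \<in> T}"
  have "continuous_map ?P (prod_topology X Y) (\<lambda>p. (fst (snd p), fst p))"
    and "continuous_map ?P (prod_topology Y Z) (\<lambda>p. (fst p, snd (snd p)))"
    using continuous_map_compose[OF continuous_map_snd continuous_map_fst, of Y X Z]
      continuous_map_compose[OF continuous_map_snd continuous_map_snd, of Y X Z]
    by (auto simp: continuous_map_paired continuous_map_fst o_def)
  then have "closedin ?P ?S" "closedin ?P ?T"
    using closedin_continuous_map_preimage S T by blast+
  then have "closedin (prod_topology X Z) ((?S \<inter> ?T) `` K)"
    using K by (intro closedin_Image_compactin closedin_Int)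
  moreover have "(?S \<inter> ?T) `` K = {(x, z). \<exists>k\<in>K. (x, k) \<in> S \<and> (k, z) \<in> T}"
    using closedin_subset[OF S] closedin_subset[OF T] by fastforce
  ultimately show ?thesis
    by simp
qed

section \<open>Closed orders\<close>

lemma closed_antisym_imp_Hausdorff_space:
  assumes "closed_preorder X G" and "antisym G"
  shows "Hausdorff_space X"
proof -
  have G: "closedin (prod_topology X X) G" and refl: "refl_on (topspace X) G"
    using assms(1) by (auto simp: closed_preorder_def preorder_on_def)
  have "closedin (prod_topology X X) (G \<inter> G\<inverse>)"
    using G by (intro closedin_Int closedin_converse)
  moreover have "G \<inter> G\<inverse> = (\<lambda>x. (x, x)) ` topspace X"
    using assms(2) refl closedin_subset[OF G] by (auto simp: antisym_def refl_on_def)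
  ultimately show ?thesis
    by (simp add: Hausdorff_space_closedin_diagonal)
qed

lemma order_convexI:
  assumes refl: "refl_on A G" and trans: "trans G" and S: "S \<subseteq> A"
    and between: "\<And>y z w. \<lbrakk>y \<in> S; w \<in> S; (y, z) \<in> G; (z, w) \<in> G\<rbrakk> \<Longrightarrow> z \<in> S"
  shows "order_convex G S"
  unfolding order_convex_def decreasing_set_def increasing_set_def
proof (intro exI conjI)
  have hull: "S \<subseteq> G `` S" "S \<subseteq> G\<inverse> `` S"
    using refl S by (auto simp: refl_on_def)
  have "z \<in> S" if z: "z \<in> G\<inverse> `` S" "z \<in> G `` S" for z
  proof -
    obtain y w where "y \<in> S" "w \<in> S" "(y, z) \<in> G" "(z, w) \<in> G"
      using z by auto
    then show ?thesis
      by (rule between)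
  qed
  then show "S = G\<inverse> `` S \<inter> G `` S"
    using hull by blast
  show "G `` (G `` S) = G `` S"
  proof (rule equalityI)
    show "G `` (G `` S) \<subseteq> G `` S"
      using trans by (auto dest: transD)
    show "G `` S \<subseteq> G `` (G `` S)"
      by (rule Image_mono[OF order_refl hull(1)])
  qed
  show "G\<inverse> `` (G\<inverse> `` S) = G\<inverse> `` S"
  proof (rule equalityI)
    show "G\<inverse> `` (G\<inverse> `` S) \<subseteq> G\<inverse> `` S"
      using trans by (auto dest: transD)
    show "G\<inverse> `` S \<subseteq> G\<inverse> `` (G\<inverse> `` S)"
      by (rule Image_mono[OF order_refl hull(2)])
  qed
qed

section \<open>Compact generation\<close>

text \<open>
  Minimality of the generated order makes this an induction over its pairs. The set \<open>C - Q\<close> has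
  to be part of the set of intermediate points because a limit of pairs inside \<open>Q\<close> may end on the
  boundary of \<open>Q\<close>.
\<close>

lemma compactly_generated_intermediate_point:
  assumes G: "closed_preorder X G" and "R \<subseteq> G"
    and minimal: "\<And>H. \<lbrakk>closed_preorder X H; R \<subseteq> H\<rbrakk> \<Longrightarrow> G \<subseteq> H"
    and Q: "openin X Q" and "Q \<subseteq> C" and C: "closedin X C"
    and K: "compactin X K" and "R `` Q - Q \<subseteq> K" and "C - Q \<subseteq> K"
    and yz: "(y, z) \<in> G" "y \<in> Q" "z \<notin> Q"
  obtains k where "k \<in> K" "(y, k) \<in> G" "(k, z) \<in> G"
proof -
  have clG: "closedin (prod_topology X X) G" and refl: "refl_on (topspace X) G"
    and trans: "trans G"
    using G by (auto simp: closed_preorder_def preorder_on_def)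
  have sub: "G \<subseteq> topspace X \<times> topspace X"
    using closedin_subset[OF clG] by simp
  define via where "via = {(y, z). \<exists>k\<in>K. (y, k) \<in> G \<and> (k, z) \<in> G}"
  define H where "H = {(y, z) \<in> G. y \<in> Q \<longrightarrow> z \<notin> Q \<longrightarrow> (y, z) \<in> via}"
  have via_endpoint: "(y, z) \<in> via" if "(y, z) \<in> G" "z \<in> K" for y z
    using that refl sub by (auto simp: via_def refl_on_def)
  have "closedin (prod_topology X X) H"
  proof -
    \<comment> \<open>A pair that ends in \<open>C - Q\<close> passes through its own endpoint, so the open condition
      \<open>z \<in> Q\<close> may be replaced by the closed condition \<open>z \<in> C\<close>.\<close>
    have "H = G \<inter> ((topspace X - Q) \<times> topspace X \<union> topspace X \<times> C \<union> via)"
      using sub via_endpoint \<open>Q \<subseteq> C\<close> \<open>C - Q \<subseteq> K\<close> unfolding H_def by blast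
    moreover have "closedin (prod_topology X X) via"
      unfolding via_def by (rule closedin_relcomp_via_compactin[OF clG clG K])
    moreover have "closedin (prod_topology X X) ((topspace X - Q) \<times> topspace X)"
      "closedin (prod_topology X X) (topspace X \<times> C)"
      using Q C by (auto simp: closedin_prod_Times_iff)
    ultimately show ?thesis
      using clG by (auto intro!: closedin_Int closedin_Un)
  qed
  moreover have "preorder_on (topspace X) H"
  proof -
    have "refl_on (topspace X) H"
      using refl by (auto simp: H_def refl_on_def)
    moreover have "trans H"
    proof (rule transI)
      fix a b c
      assume ab: "(a, b) \<in> H" and bc: "(b, c) \<in> H"
      then have G: "(a, b) \<in> G" "(b, c) \<in> G" "(a, c) \<in> G"
        using trans by (auto simp: H_def dest: transD)
      moreover have "(a, c) \<in> via" if "a \<in> Q" "c \<notin> Q"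
      proof (cases "b \<in> Q")
        case True
        then obtain k where "k \<in> K" "(b, k) \<in> G" "(k, c) \<in> G"
          using bc True \<open>c \<notin> Q\<close> by (auto simp: H_def via_def)
        then show ?thesis
          using G trans by (auto simp: via_def dest: transD)
      next
        case False
        then obtain k where "k \<in> K" "(a, k) \<in> G" "(k, b) \<in> G"
          using ab False \<open>a \<in> Q\<close> by (auto simp: H_def via_def)
        then show ?thesis
          using G trans by (auto simp: via_def dest: transD)
      qed
      ultimately show "(a, c) \<in> H"
        by (auto simp: H_def)
    qed
    moreover have "H \<subseteq> topspace X \<times> topspace X"
      using sub by (auto simp: H_def)
    ultimately show ?thesis
      by (simp add: preorder_on_def)
  qed
  moreover have "R \<subseteq> H"
    using \<open>R \<subseteq> G\<close> \<open>R `` Q - Q \<subseteq> K\<close> via_endpoint unfolding H_def by blast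
  ultimately have "G \<subseteq> H"
    using minimal by (simp add: closed_preorder_def)
  then show ?thesis
    using yz that by (auto simp: H_def via_def)
qed

text \<open>
  The relation of being joined through a compact set is closed. For a compact set outside \<open>Q\<close> it
  omits \<open>(x, x)\<close> by antisymmetry, hence it omits all pairs near \<open>(x, x)\<close>.
\<close>

lemma small_neighbourhood_hull:
  assumes G: "k_T2_ordered X G"
    and Q: "openin X Q" and C: "compactin X C" and "Q \<subseteq> C" and x: "x \<in> Q"
  obtains W where "openin X W" "x \<in> W" "W \<subseteq> Q"
    and "\<And>y z w. \<lbrakk>y \<in> W; w \<in> W; (y, z) \<in> G; (z, w) \<in> G\<rbrakk> \<Longrightarrow> z \<in> Q"
proof -
  have cpG: "closed_preorder X G" and antisym: "antisym G"
    using G by (auto simp: k_T2_ordered_def k_T2_preordered_def)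
  obtain R where "R \<subseteq> G"
    and R: "\<forall>K. compactin X K \<longrightarrow> compactin X (X closure_of (R `` K))"
    and least: "\<forall>H. closed_preorder X H \<and> R \<subseteq> H \<longrightarrow> G \<subseteq> H"
    using G unfolding k_T2_ordered_def k_T2_preordered_def by metis
  have minimal: "G \<subseteq> H" if "closed_preorder X H" "R \<subseteq> H" for H
    using least that by simp
  have clG: "closedin (prod_topology X X) G" and trans: "trans G"
    using cpG by (auto simp: closed_preorder_def preorder_on_def)
  have clC: "closedin X C"
    using C closed_antisym_imp_Hausdorff_space[OF cpG antisym]
    by (rule compactin_imp_closedin[rotated])
  define K where "K = (X closure_of (R `` C) \<union> C) - Q"
  have K: "compactin X K"
    unfolding K_def using R C Q by (intro compactin_Diff_openin compactin_Un) auto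
  have "R `` Q - Q \<subseteq> K"
  proof -
    have "R `` C \<subseteq> X closure_of (R `` C)"
      using \<open>R \<subseteq> G\<close> closedin_subset[OF clG] by (intro closure_of_subset) auto
    then show ?thesis
      using \<open>Q \<subseteq> C\<close> unfolding K_def by blast
  qed
  moreover have "C - Q \<subseteq> K"
    by (auto simp: K_def)
  ultimately have exit: "\<exists>k\<in>K. (y, k) \<in> G \<and> (k, z) \<in> G"
    if "(y, z) \<in> G" "y \<in> Q" "z \<notin> Q" for y z
    using compactly_generated_intermediate_point[OF cpG \<open>R \<subseteq> G\<close> minimal Q \<open>Q \<subseteq> C\<close> clC K _ _ that]
    by metis
  let ?via = "{(y, w). \<exists>k\<in>K. (y, k) \<in> G \<and> (k, w) \<in> G}"
  have "openin (prod_topology X X) (topspace X \<times> topspace X - ?via)"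
    using closedin_relcomp_via_compactin[OF clG clG K] by (simp add: closedin_def)
  moreover have "(x, x) \<in> topspace X \<times> topspace X - ?via"
    using antisym x openin_subset[OF Q] by (auto simp: K_def dest: antisymD)
  ultimately obtain A B where AB: "openin X A" "openin X B" "x \<in> A" "x \<in> B"
      "A \<times> B \<subseteq> topspace X \<times> topspace X - ?via"
    unfolding openin_prod_topology_alt by meson
  show ?thesis
  proof
    show "openin X (A \<inter> B \<inter> Q)" "x \<in> A \<inter> B \<inter> Q" "A \<inter> B \<inter> Q \<subseteq> Q"
      using AB Q x by auto
  next
    fix y z w
    assume y: "y \<in> A \<inter> B \<inter> Q" and w: "w \<in> A \<inter> B \<inter> Q" and yz: "(y, z) \<in> G" and zw: "(z, w) \<in> G"
    show "z \<in> Q"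
    proof (rule ccontr)
      assume "z \<notin> Q"
      then obtain k where "k \<in> K" "(y, k) \<in> G" "(k, z) \<in> G"
        using exit yz y by blast
      then have "(y, w) \<in> ?via"
        using trans zw by (auto dest: transD)
      then show False
        using AB(5) y w by blast
    qed
  qed
qed

section \<open>Convex neighbourhoods\<close>

text \<open>
  The sets \<open>A\<^sub>1\<close> and \<open>A\<^sub>2\<close> exist because the points of \<open>A\<close> below \<open>x\<close> and those above \<open>x\<close> form
  disjoint compact sets, which have disjoint neighbourhoods in a Hausdorff space.
\<close>

lemma compactin_split_at_point:
  assumes G: "closed_preorder X G" and "antisym G"
    and A: "compactin X A" and x: "x \<in> topspace X" "x \<notin> A"
  obtains A\<^sub>1 A\<^sub>2 where "compactin X A\<^sub>1" "compactin X A\<^sub>2" "A = A\<^sub>1 \<union> A\<^sub>2"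
    "x \<notin> G `` A\<^sub>1" "x \<notin> G\<inverse> `` A\<^sub>2"
proof -
  have clG: "closedin (prod_topology X X) G"
    using G by (simp add: closed_preorder_def)
  have pt: "compactin X {x}"
    using x by simp
  have cl: "closedin X (G\<inverse> `` {x})" "closedin X (G `` {x})"
    using closedin_Image_compactin[OF _ pt] closedin_converse clG by blast+
  then have "compactin X (A \<inter> G\<inverse> `` {x})" "compactin X (A \<inter> G `` {x})"
    using A by (auto intro: compact_Int_closedin)
  moreover have "disjnt (A \<inter> G\<inverse> `` {x}) (A \<inter> G `` {x})"
    using \<open>antisym G\<close> x by (auto simp: disjnt_def dest: antisymD)
  ultimately obtain U V where UV: "openin X U" "openin X V"
    "A \<inter> G\<inverse> `` {x} \<subseteq> U" "A \<inter> G `` {x} \<subseteq> V" "disjnt U V"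
    using Hausdorff_space_compact_separation[of X]
      closed_antisym_imp_Hausdorff_space[OF G \<open>antisym G\<close>] by metis
  show ?thesis
  proof
    show "compactin X (A - U)" "compactin X (A - V)"
      using A UV by (auto intro: compactin_Diff_openin)
    show "A = (A - U) \<union> (A - V)"
      using UV(5) by (auto simp: disjnt_def)
    show "x \<notin> G `` (A - U)" "x \<notin> G\<inverse> `` (A - V)"
      using UV(3,4) by auto
  qed
qed

theorem corollary4p12:
  fixes X :: "'a topology" and G :: "'a rel"
  assumes "k_T2_ordered X G"
    and "locally_compact_space X"
  shows "weakly_convex X G"
proof -
  have cpG: "closed_preorder X G" and antisym: "antisym G"
    using assms(1) by (auto simp: k_T2_ordered_def k_T2_preordered_def)
  have clG: "closedin (prod_topology X X) G" and refl: "refl_on (topspace X) G"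
    and trans: "trans G"
    using cpG by (auto simp: closed_preorder_def preorder_on_def)
  have base: "neighbourhood_base_of (compactin X) X"
    using assms(2) closed_antisym_imp_Hausdorff_space[OF cpG antisym]
    by (simp add: locally_compact_space_neighbourhood_base)
  have "\<exists>V. openin X V \<and> order_convex G V \<and> x \<in> V \<and> V \<subseteq> U"
    if U: "openin X U" "x \<in> U" for x U
  proof -
    obtain Q C where Q: "openin X Q" "compactin X C" "Q \<subseteq> C" "x \<in> Q" and "C \<subseteq> U"
      using base U unfolding neighbourhood_base_of by meson
    obtain W where W: "openin X W" "x \<in> W" "W \<subseteq> Q"
      and hull: "\<And>y z w. \<lbrakk>y \<in> W; w \<in> W; (y, z) \<in> G; (z, w) \<in> G\<rbrakk> \<Longrightarrow> z \<in> Q"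
      using small_neighbourhood_hull[OF assms(1) Q] by metis
    have "compactin X (C - W)" "x \<in> topspace X" "x \<notin> C - W"
      using Q W openin_subset[OF W(1)] by (auto intro: compactin_Diff_openin)
    from compactin_split_at_point[OF cpG antisym this]
    obtain A\<^sub>1 A\<^sub>2 where A: "compactin X A\<^sub>1" "compactin X A\<^sub>2" "C - W = A\<^sub>1 \<union> A\<^sub>2"
      "x \<notin> G `` A\<^sub>1" "x \<notin> G\<inverse> `` A\<^sub>2" .
    define V where "V = W - G `` A\<^sub>1 - G\<inverse> `` A\<^sub>2"
    have "openin X V"
      unfolding V_def using W(1) A(1,2) clG
      by (intro openin_diff closedin_Image_compactin closedin_converse)
    moreover have "order_convex G V"
    proof (rule order_convexI[OF refl trans])
      show "V \<subseteq> topspace X"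
        using openin_subset[OF \<open>openin X V\<close>] .
    next
      fix y z w
      assume y: "y \<in> V" and w: "w \<in> V" and yz: "(y, z) \<in> G" and zw: "(z, w) \<in> G"
      have z: "z \<notin> G `` A\<^sub>1" "z \<notin> G\<inverse> `` A\<^sub>2"
        using y w yz zw trans unfolding V_def by (blast dest: transD)+
      have "(z, z) \<in> G"
        using refl yz closedin_subset[OF clG] by (auto simp: refl_on_def)
      with z have "z \<notin> C - W"
        unfolding A(3) by blast
      moreover have "z \<in> C"
        using hull[of y w z] y w yz zw \<open>Q \<subseteq> C\<close> by (auto simp: V_def)
      ultimately show "z \<in> V"
        using z by (simp add: V_def)
    qed
    moreover have "x \<in> V" "V \<subseteq> U"
      using W A Q \<open>C \<subseteq> U\<close> by (auto simp: V_def)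
    ultimately show ?thesis
      by blast
  qed
  then show ?thesis
    unfolding weakly_convex_def weakly_convex_at_def neighbourhood_base_at_def
    by (meson order_refl)
qed

end
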